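(* Let $n$ be a positive integer and let $E_m$ denote the $m$-th Euler polynomial. Then $$\int_0^{\frac{\pi}{2}} E_{2n}\!\left(\tfrac{2}{\pi}x\right)\log(\tan x)\,\mathrm{d}x=0$$ and $$\int_0^{\frac{\pi}{2}} E_{2n-1}\!\left(\tfrac{2}{\pi}x\right)\log(\tan x)\,\mathrm{d}x=\frac{(-1)^{n-1}(2n-1)!}{\pi^{2n-1}}\left(2-2^{-2n}\right)\zeta(2n+1).$$
   Context: The Euler polynomials $E_m(x)$, $m\ge 0$, are defined by the generating function $\frac{2e^{tx}}{e^t+1}=\sum_{m\ge0}E_m(x)\frac{t^m}{m!}$ for $|t|<\pi$. $\zeta$ is the Riemann zeta function, $\zeta(s)=\sum_{k\ge1}k^{-s}$. *)

theory Defs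
  imports "HOL-Complex_Analysis.Complex_Analysis"
begin

text \<open>
  The Euler polynomials, read off from the exponential generating function
  \<open>2 e\<^sup>t\<^sup>x / (e\<^sup>t + 1)\<close>, a formal power series in \<open>t\<close> for each fixed \<open>x\<close>;
  \<open>euler_poly_sums\<close> below is the corresponding convergent expansion for \<open>\<bar>t\<bar> < \<pi>\<close>.
\<close>

definition euler_poly :: "nat \<Rightarrow> real \<Rightarrow> real" where
  "euler_poly m x = fact m * fps_nth (2 * fps_exp x / (fps_exp 1 + 1)) m"

text \<open>The Dirichlet series, so only meaningful for \<open>s > 1\<close> (no analytic continuation).\<close>

definition zeta :: "real \<Rightarrow> real" where
  "zeta s = (\<Sum>k. real (Suc k) powr (- s))"

lemma exp_plus_1_nonzero:
  assumes "norm (t :: complex) < pi"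
  shows   "exp t + 1 \<noteq> 0"
proof
  assume "exp t + 1 = 0"
  hence "exp t = exp (\<i> * of_real pi)"
    by (simp add: eq_neg_iff_add_eq_0)
  then obtain n :: int where n: "t = \<i> * of_real pi + (of_int (2 * n) * pi) * \<i>"
    using exp_eq[of t "\<i> * of_real pi"] by blast
  hence "t = of_real (of_int (2 * n + 1) * pi) * \<i>"
    by (simp add: algebra_simps)
  hence "norm t = \<bar>of_int (2 * n + 1)\<bar> * pi"
    by (simp only: norm_mult norm_of_real abs_mult) simp
  moreover have "1 \<le> \<bar>2 * n + 1\<bar>"
    by presburger
  hence "(1 :: real) \<le> \<bar>of_int (2 * n + 1)\<bar>"
    by (simp only: of_int_1_le_iff flip: of_int_abs)
  ultimately have "pi \<le> norm t"
    using mult_right_mono[of 1 "\<bar>of_int (2 * n + 1)\<bar> :: real" pi] by simp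
  with assms show False
    by simp
qed

theorem euler_poly_sums:
  fixes t x :: real
  assumes "\<bar>t\<bar> < pi"
  shows   "(\<lambda>m. euler_poly m x * t ^ m / fact m) sums (2 * exp (t * x) / (exp t + 1))"
proof -
  define F where "F = (2 * fps_exp x / (fps_exp 1 + 1) :: real fps)"
  define G where "G = (2 * fps_exp (of_real x) / (fps_exp 1 + 1) :: complex fps)"
  define H where "H = (Abs_fps (\<lambda>n. of_real (fps_nth F n)) :: complex fps)"
  have unit_real: "fps_nth (fps_exp 1 + 1 :: real fps) 0 \<noteq> 0"
    and unit_complex: "fps_nth (fps_exp 1 + 1 :: complex fps) 0 \<noteq> 0"
    by simp_all
  have F: "F * (fps_exp 1 + 1) = 2 * fps_exp x"
    unfolding F_def by (rule dvd_div_mult_self, rule unit_imp_dvd) simp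
  have G: "G * (fps_exp 1 + 1) = 2 * fps_exp (of_real x)"
    unfolding G_def by (rule dvd_div_mult_self, rule unit_imp_dvd) simp
  have "H * (fps_exp 1 + 1) = 2 * fps_exp (of_real x)"
  proof (rule fps_ext)
    fix n
    have "fps_nth (H * (fps_exp 1 + 1)) n = complex_of_real (fps_nth (F * (fps_exp 1 + 1)) n)"
      by (simp add: H_def fps_mult_nth if_distrib cong: if_cong)
    also have "\<dots> = fps_nth (2 * fps_exp (of_real x)) n"
      unfolding F by (simp add: numeral_fps_const)
    finally show "fps_nth (H * (fps_exp 1 + 1)) n = fps_nth (2 * fps_exp (of_real x)) n" .
  qed
  hence "H * (fps_exp 1 + 1) = G * (fps_exp 1 + 1)"
    using G by simp
  moreover have "(fps_exp 1 + 1 :: complex fps) \<noteq> 0"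
    using unit_complex fps_nonzeroI by blast
  ultimately have "H = G"
    by simp
  have "(\<lambda>z. 2 * exp (of_real x * z) / (exp z + 1)) has_fps_expansion G"
    unfolding G_def using unit_complex by (intro fps_expansion_intros) auto
  moreover have "(\<lambda>z. 2 * exp (of_real x * z) / (exp z + 1)) holomorphic_on eball 0 (ereal pi)"
    by (intro holomorphic_intros) (auto simp: exp_plus_1_nonzero)
  moreover have "ereal (norm (complex_of_real t)) < ereal pi"
    using assms by simp
  ultimately have "(\<lambda>n. fps_nth G n * of_real t ^ n) sums
                     (2 * exp (of_real x * of_real t) / (exp (complex_of_real t) + 1))"
    by (rule has_fps_expansion_imp_sums_complex)
  hence "(\<lambda>n. complex_of_real (fps_nth F n * t ^ n)) sums
           complex_of_real (2 * exp (t * x) / (exp t + 1))"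
    unfolding \<open>H = G\<close>[symmetric] by (simp add: H_def mult.commute flip: exp_of_real)
  hence "(\<lambda>n. fps_nth F n * t ^ n) sums (2 * exp (t * x) / (exp t + 1))"
    by (subst (asm) sums_of_real_iff)
  thus ?thesis
    by (simp add: euler_poly_def F_def)
qed

end

theory Submission
  imports Defs
begin

text \<open>
  Termwise antiderivatives of the Fourier series \<open>ln (tan x) = - 2 * (\<Sum>k odd. cos (2 k x) / k)\<close>
  give functions \<open>L\<^sub>j\<close> with \<open>L\<^sub>0 = ln \<circ> tan\<close>, \<open>L\<^sub>j\<^sub>+\<^sub>1' = L\<^sub>j\<close> and \<open>L\<^sub>j (\<pi>/2) = - L\<^sub>j 0\<close> for
  \<open>j > 0\<close>. Since \<open>E\<^sub>m' = m E\<^sub>m\<^sub>-\<^sub>1\<close> and \<open>E\<^sub>m 0 + E\<^sub>m 1 = 0\<close> for \<open>m > 0\<close>, integrating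
  \<open>E\<^sub>m (2x/\<pi>) L\<^sub>0 x\<close> by parts produces no boundary terms until \<open>E\<^sub>0 = 1\<close> is reached, where
  \<open>- 2 L\<^sub>m\<^sub>+\<^sub>1 0\<close>, a multiple of \<open>\<zeta>(m + 2)\<close>, remains. It vanishes for even \<open>m\<close>.
\<close>

section \<open>Euler polynomials\<close>

text \<open>The Appell normalisation \<open>E_m(x) / m!\<close>, for which differentiation lowers
  the index without a factor.\<close>

definition euler_appell :: "nat \<Rightarrow> real \<Rightarrow> real" where
  "euler_appell m x = fps_nth (2 * fps_exp x / (fps_exp 1 + 1)) m"

lemma euler_poly_conv_appell: "euler_poly m x = fact m * euler_appell m x"
  by (simp add: euler_poly_def euler_appell_def)

lemma euler_appell_fps:
  "Abs_fps (\<lambda>m. euler_appell m x) = fps_exp x * (2 * inverse (fps_exp 1 + 1))"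
proof -
  have "2 * fps_exp x / (fps_exp 1 + 1 :: real fps) = 2 * fps_exp x * inverse (fps_exp 1 + 1)"
    by (rule fps_divide_unit) simp
  thus ?thesis
    by (simp add: euler_appell_def fps_eq_iff mult_ac)
qed

text \<open>The Cauchy product of the two factors shows a polynomial in \<open>x\<close>, which can
  be differentiated term by term.\<close>

lemma euler_appell_altdef:
  "euler_appell m x = (\<Sum>i\<le>m. x ^ i / fact i * fps_nth (2 * inverse (fps_exp 1 + 1)) (m - i))"
proof -
  have "euler_appell m x = fps_nth (Abs_fps (\<lambda>m. euler_appell m x)) m"
    by simp
  also have "\<dots> = (\<Sum>i\<le>m. x ^ i / fact i * fps_nth (2 * inverse (fps_exp 1 + 1)) (m - i))"
    unfolding euler_appell_fps by (simp add: fps_mult_nth atLeast0AtMost)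
  finally show ?thesis .
qed

lemma euler_appell_0: "euler_appell 0 x = 1"
  by (simp add: euler_appell_altdef numeral_fps_const)

lemma euler_appell_has_derivative:
  "(euler_appell (Suc m) has_real_derivative euler_appell m x) (at x)"
proof -
  define g where "g = (\<lambda>i. fps_nth (2 * inverse (fps_exp 1 + 1) :: real fps) i)"
  have eq: "euler_appell (Suc m) =
              (\<lambda>x. g (Suc m) + (\<Sum>i\<le>m. x ^ Suc i / fact (Suc i) * g (m - i)))"
    by (rule ext, unfold euler_appell_altdef g_def, subst sum.atMost_Suc_shift) simp
  have "((\<lambda>x. x ^ Suc i / fact (Suc i) * g (m - i)) has_real_derivative
           x ^ i / fact i * g (m - i)) (at x)" for i
  proof -
    have "((\<lambda>x. x ^ Suc i) has_real_derivative real (Suc i) * x ^ i) (at x)"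
      by (auto intro!: derivative_eq_intros simp del: of_nat_Suc power_Suc)
    hence "((\<lambda>x. x ^ Suc i * (g (m - i) / fact (Suc i))) has_real_derivative
             real (Suc i) * x ^ i * (g (m - i) / fact (Suc i))) (at x)"
      by (rule DERIV_cmult_right)
    thus ?thesis
      by (simp add: field_simps del: of_nat_Suc power_Suc)
  qed
  hence "((\<lambda>x. \<Sum>i\<le>m. x ^ Suc i / fact (Suc i) * g (m - i)) has_real_derivative
           (\<Sum>i\<le>m. x ^ i / fact i * g (m - i))) (at x)"
    by (rule DERIV_sum)
  hence "((\<lambda>x. g (Suc m) + (\<Sum>i\<le>m. x ^ Suc i / fact (Suc i) * g (m - i))) has_real_derivative
           0 + (\<Sum>i\<le>m. x ^ i / fact i * g (m - i))) (at x)"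
    by (intro DERIV_add DERIV_const)
  thus ?thesis
    unfolding eq euler_appell_altdef by (simp add: g_def)
qed

text \<open>The generating functions at 0 and 1 add up to
  \<open>2 (1 + e^t) / (e^t + 1) = 2\<close>, a constant, so all coefficients of positive index
  cancel.\<close>

lemma euler_appell_0_plus_1: "euler_appell (Suc m) 0 + euler_appell (Suc m) 1 = 0"
proof -
  define G where "G = (fps_exp 1 + 1 :: real fps)"
  have "inverse G * G = 1"
    by (rule inverse_mult_eq_1) (simp add: G_def)
  moreover have "1 * (2 * inverse G) + fps_exp 1 * (2 * inverse G) = 2 * (inverse G * G)"
    by (simp add: G_def algebra_simps)
  ultimately have "1 * (2 * inverse G) + fps_exp 1 * (2 * inverse G) = 2"
    by simp
  hence "Abs_fps (\<lambda>m. euler_appell m 0) + Abs_fps (\<lambda>m. euler_appell m 1) = 2"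
    unfolding euler_appell_fps G_def by simp
  hence "fps_nth (Abs_fps (\<lambda>m. euler_appell m 0) + Abs_fps (\<lambda>m. euler_appell m 1)) (Suc m) =
           fps_nth 2 (Suc m)"
    by (rule arg_cong)
  thus ?thesis
    by (simp add: numeral_fps_const)
qed

section \<open>Iterated antiderivatives of the logarithmic tangent\<close>

text \<open>Since \<open>cos (y - pi / 2) = sin y\<close>, a phase shift by \<open>pi / 2\<close>
  keeps antiderivatives of cosines in cosine form, so that all iterates have the same shape. The
  Weierstrass test on the differentiated series justifies working termwise.\<close>

lemma has_derivative_cos_series:
  fixes a :: "nat \<Rightarrow> real"
  assumes "summable (\<lambda>k. \<bar>a k\<bar>)" and "summable (\<lambda>k. \<bar>2 * real k * a k\<bar>)"
  shows "((\<lambda>x. \<Sum>k. a k * cos (2 * real k * x - (\<phi> + pi / 2))) has_real_derivative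
           (\<Sum>k. 2 * real k * a k * cos (2 * real k * x - \<phi>))) (at x)"
proof (rule has_field_derivative_series'(2)[where S = UNIV and ?x0.0 = 0])
  fix k :: nat and x :: real
  have "sin (2 * real k * x - (\<phi> + pi / 2)) = - cos (2 * real k * x - \<phi>)"
    by (simp add: sin_diff cos_diff sin_add cos_add algebra_simps)
  thus "((\<lambda>x. a k * cos (2 * real k * x - (\<phi> + pi / 2))) has_real_derivative
           2 * real k * a k * cos (2 * real k * x - \<phi>)) (at x within UNIV)"
    by (auto intro!: derivative_eq_intros)
next
  show "uniformly_convergent_on UNIV
          (\<lambda>n x. \<Sum>k<n. 2 * real k * a k * cos (2 * real k * x - \<phi>))"
  proof (rule Weierstrass_m_test')
    fix k x
    show "norm (2 * real k * a k * cos (2 * real k * x - \<phi>)) \<le> \<bar>2 * real k * a k\<bar>"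
      unfolding real_norm_def abs_mult[of _ "cos _"] by (rule mult_left_le) auto
  qed (rule assms)
next
  show "summable (\<lambda>k. a k * cos (2 * real k * 0 - (\<phi> + pi / 2)))"
  proof (rule summable_comparison_test'[OF assms(1)])
    fix k
    show "norm (a k * cos (2 * real k * 0 - (\<phi> + pi / 2))) \<le> \<bar>a k\<bar>"
      unfolding real_norm_def abs_mult by (rule mult_left_le) auto
  qed
qed auto

text \<open>Twice the indicator of the odd numbers, in the form that appears when the series of
  \<open>Ln (1 - w)\<close> and \<open>Ln (1 + w)\<close> are subtracted.\<close>

definition odd_coeff :: "nat \<Rightarrow> real" where
  "odd_coeff k = 1 - (- 1) ^ k"

lemma odd_coeff_bounds: "odd_coeff k \<ge> 0" "odd_coeff k \<le> 2"
  by (cases "even k"; simp add: odd_coeff_def)+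

lemma odd_coeff_0 [simp]: "odd_coeff 0 = 0"
  by (simp add: odd_coeff_def)

text \<open>
  For \<open>j = 0\<close> the defining series would still converge to \<open>ln (tan x)\<close>, but only conditionally.
  The summand for \<open>k = 0\<close> vanishes.
\<close>

definition log_tan_prim :: "nat \<Rightarrow> real \<Rightarrow> real" where
  "log_tan_prim j x = (if j = 0 then ln (tan x) else
     (\<Sum>k. - odd_coeff k / (real k * (2 * real k) ^ j) * cos (2 * real k * x - real j * (pi / 2))))"

lemma summable_odd_coeff:
  assumes "j > 0"
  shows "summable (\<lambda>k. \<bar>- odd_coeff k / (real k * (2 * real k) ^ j)\<bar>)"
proof (rule summable_comparison_test')
  show "summable (\<lambda>k. 2 * inverse (real k ^ Suc j))"
    by (intro summable_mult inverse_power_summable) (use assms in simp)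
next
  fix k :: nat
  show "norm \<bar>- odd_coeff k / (real k * (2 * real k) ^ j)\<bar> \<le> 2 * inverse (real k ^ Suc j)"
  proof (cases "k = 0")
    case False
    have "real k ^ j \<le> (2 * real k) ^ j"
      by (rule power_mono) auto
    hence "real k ^ Suc j \<le> real k * (2 * real k) ^ j"
      by (simp add: mult_left_mono)
    hence "odd_coeff k / (real k * (2 * real k) ^ j) \<le> 2 / real k ^ Suc j"
      using False by (intro frac_le odd_coeff_bounds) auto
    thus ?thesis
      using odd_coeff_bounds(1)[of k] by (simp add: abs_mult field_simps)
  qed auto
qed

text \<open>Here the differentiated series still converges absolutely. This fails from index 1 to
  index 0, which is treated by damping below.\<close>

lemma log_tan_prim_Suc_Suc_has_derivative:
  "(log_tan_prim (Suc (Suc j)) has_real_derivative log_tan_prim (Suc j) x) (at x)"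
proof -
  \<comment> \<open>At \<open>k = 0\<close> both sides are 0, by the convention for division by
    zero.\<close>
  have eq: "2 * real k * (- odd_coeff k / (real k * (2 * real k) ^ Suc (Suc j))) =
          - odd_coeff k / (real k * (2 * real k) ^ Suc j)" for k
    by (cases "k = 0") auto
  have "((\<lambda>x. \<Sum>k. - odd_coeff k / (real k * (2 * real k) ^ Suc (Suc j)) *
            cos (2 * real k * x - (real (Suc j) * (pi / 2) + pi / 2))) has_real_derivative
         (\<Sum>k. 2 * real k * (- odd_coeff k / (real k * (2 * real k) ^ Suc (Suc j))) *
            cos (2 * real k * x - real (Suc j) * (pi / 2)))) (at x)"
    by (rule has_derivative_cos_series; (unfold eq)?; rule summable_odd_coeff) auto
  moreover have "real (Suc j) * (pi / 2) + pi / 2 = real (Suc (Suc j)) * (pi / 2)"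
    by (simp add: field_simps)
  ultimately show ?thesis
    unfolding log_tan_prim_def eq by (simp only: nat.simps if_False)
qed

text \<open>Moving from 0 to \<open>pi / 2\<close> changes the argument of the cosine by
  \<open>k * pi\<close>. Only odd \<open>k\<close> contribute, and for these the sign flips.\<close>

lemma log_tan_prim_pi_half:
  assumes "j > 0"
  shows "log_tan_prim j (pi / 2) = - log_tan_prim j 0"
proof -
  have eq: "- odd_coeff k / (real k * (2 * real k) ^ j) *
          cos (2 * real k * (pi / 2) - real j * (pi / 2)) =
        - (- odd_coeff k / (real k * (2 * real k) ^ j) *
          cos (2 * real k * 0 - real j * (pi / 2)))" for k
  proof -
    have "odd_coeff k * cos (2 * real k * (pi / 2) - real j * (pi / 2)) =
            - (odd_coeff k * cos (2 * real k * 0 - real j * (pi / 2)))"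
      by (cases "even k") (simp_all add: odd_coeff_def cos_diff)
    thus ?thesis
      by (simp add: field_simps)
  qed
  have "summable (\<lambda>k. - odd_coeff k / (real k * (2 * real k) ^ j) *
          cos (2 * real k * 0 - real j * (pi / 2)))"
  proof (rule summable_comparison_test'[OF summable_odd_coeff[OF assms]])
    fix k
    show "norm (- odd_coeff k / (real k * (2 * real k) ^ j) *
             cos (2 * real k * 0 - real j * (pi / 2)))
          \<le> \<bar>- odd_coeff k / (real k * (2 * real k) ^ j)\<bar>"
      unfolding real_norm_def abs_mult by (rule mult_left_le) auto
  qed
  thus ?thesis
    unfolding log_tan_prim_def eq if_not_P[OF assms[THEN gr_implies_not0]] by (rule suminf_minus)
qed

section \<open>Abel summation for the first antiderivative\<close>

text \<open>
  To differentiate the first antiderivative we damp its series by \<open>r ^ k\<close>, \<open>0 \<le> r < 1\<close>. The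
  damped derivative is the real part of \<open>Ln (1 - w) - Ln (1 + w)\<close> at \<open>w = r * cis (2 * t)\<close>,
  which stays jointly continuous up to \<open>r = 1\<close> as long as \<open>w\<close> avoids \<open>\<plusminus>1\<close>.
\<close>

definition damped_log_tan :: "real \<Rightarrow> real \<Rightarrow> real" where
  "damped_log_tan r t =
     ln (norm (1 - of_real r * cis (2 * t))) - ln (norm (1 + of_real r * cis (2 * t)))"

definition damped_prim :: "real \<Rightarrow> real \<Rightarrow> real" where
  "damped_prim r x =
     (\<Sum>k. - odd_coeff k / (real k * (2 * real k)) * r ^ k * cos (2 * real k * x - pi / 2))"

lemma damped_log_tan_sums:
  assumes "0 \<le> r" "r < 1"
  shows "(\<lambda>k. - odd_coeff k / real k * r ^ k * cos (2 * real k * t)) sums damped_log_tan r t"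
proof -
  define w where "w = of_real r * cis (2 * t)"
  have w: "norm w < 1" "norm (- w) < 1"
    using assms by (simp_all add: w_def norm_mult)
  have nz: "1 - w \<noteq> 0" "1 + w \<noteq> 0"
    using w by (auto simp: add_eq_0_iff norm_minus_cancel)
  \<comment> \<open>Both logarithm series may start at \<open>k = 0\<close>, where the terms are
    divided by zero and hence 0.\<close>
  have "(\<lambda>k. - ((- (- w)) ^ k) / of_nat k - - ((- w) ^ k) / of_nat k) sums
          (Ln (1 + - w) - Ln (1 + w))"
    by (intro sums_diff Ln_series' w)
  hence "(\<lambda>k. Re (- ((- (- w)) ^ k) / of_nat k - - ((- w) ^ k) / of_nat k)) sums
          Re (Ln (1 + - w) - Ln (1 + w))"
    by (rule sums_Re)
  also have "Re (Ln (1 + - w) - Ln (1 + w)) = damped_log_tan r t"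
    using nz by (simp add: damped_log_tan_def w_def)
  also have "(\<lambda>k. Re (- ((- (- w)) ^ k) / of_nat k - - ((- w) ^ k) / of_nat k)) =
          (\<lambda>k. - odd_coeff k / real k * r ^ k * cos (2 * real k * t))"
  proof
    fix k
    have "- ((- (- w)) ^ k) / of_nat k - - ((- w) ^ k) / of_nat k =
            of_real (- odd_coeff k / real k * r ^ k) * cis (real k * (2 * t))"
      by (simp add: w_def power_minus[of "_ * _"] power_mult_distrib Complex.DeMoivre odd_coeff_def
            ring_distribs diff_divide_distrib)
    thus "Re (- ((- (- w)) ^ k) / of_nat k - - ((- w) ^ k) / of_nat k) =
            - odd_coeff k / real k * r ^ k * cos (2 * real k * t)"
      by (simp add: mult_ac)
  qed
  finally show ?thesis .
qed

text \<open>For \<open>r < 1\<close> the geometric factor dominates the differentiated series as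
  well, so termwise differentiation is allowed.\<close>

lemma damped_prim_has_derivative:
  assumes "0 \<le> r" "r < 1"
  shows "(damped_prim r has_real_derivative damped_log_tan r x) (at x)"
proof -
  define a where "a = (\<lambda>k. - odd_coeff k / (real k * (2 * real k)) * r ^ k)"
  have geom: "summable (\<lambda>k. 2 * r ^ k)"
    using assms by (intro summable_mult summable_geometric) simp
  have eq: "2 * real k * a k = - odd_coeff k / real k * r ^ k" for k
    by (cases "k = 0") (auto simp: a_def)
  have bound: "odd_coeff k / c * r ^ k \<le> 2 * r ^ k" if "c \<ge> 1" for k c
  proof (rule mult_right_mono)
    have "odd_coeff k / c \<le> 2 / 1"
      using that by (intro frac_le odd_coeff_bounds) auto
    thus "odd_coeff k / c \<le> 2" by simp
  qed (use assms in auto)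
  have "((\<lambda>x. \<Sum>k. a k * cos (2 * real k * x - (0 + pi / 2))) has_real_derivative
           (\<Sum>k. 2 * real k * a k * cos (2 * real k * x - 0))) (at x)"
  proof (rule has_derivative_cos_series)
    show "summable (\<lambda>k. \<bar>a k\<bar>)"
    proof (rule summable_comparison_test'[OF geom])
      fix k
      show "norm \<bar>a k\<bar> \<le> 2 * r ^ k"
      proof (cases "k = 0")
        case False
        hence "1 * 1 \<le> real k * (2 * real k)"
          by (intro mult_mono) auto
        thus ?thesis
          using bound[of "real k * (2 * real k)" k] odd_coeff_bounds(1)[of k] assms
          by (simp add: a_def abs_mult)
      qed (auto simp: a_def)
    qed
    show "summable (\<lambda>k. \<bar>2 * real k * a k\<bar>)"
    proof (rule summable_comparison_test'[OF geom])
      fix k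
      show "norm \<bar>2 * real k * a k\<bar> \<le> 2 * r ^ k"
      proof (cases "k = 0")
        case False
        thus ?thesis
          using bound[of "real k" k] odd_coeff_bounds(1)[of k] assms
          unfolding eq by (simp add: abs_mult)
      qed (auto simp: a_def)
    qed
  qed
  moreover have "(\<Sum>k. 2 * real k * a k * cos (2 * real k * x - 0)) = damped_log_tan r x"
    using damped_log_tan_sums[OF assms, of x] unfolding eq by (simp add: sums_iff)
  ultimately show ?thesis
    by (simp add: a_def damped_prim_def [abs_def])
qed

lemma damped_prim_1: "damped_prim 1 = log_tan_prim (Suc 0)"
  by (simp add: damped_prim_def log_tan_prim_def fun_eq_iff)

text \<open>The majorant obtained at \<open>r = 1\<close> is of order \<open>1 / k^2\<close> and
  serves all \<open>r\<close> at once, so continuity includes the endpoint 1.\<close>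

lemma continuous_on_damped_prim: "continuous_on {0..1} (\<lambda>r. damped_prim r x)"
proof (rule uniform_limit_theorem)
  show "uniform_limit {0..1}
    (\<lambda>n r. \<Sum>k<n. - odd_coeff k / (real k * (2 * real k)) * r ^ k * cos (2 * real k * x - pi / 2))
    (\<lambda>r. damped_prim r x) sequentially"
    unfolding damped_prim_def
  proof (rule Weierstrass_m_test)
    show "summable (\<lambda>k. \<bar>- odd_coeff k / (real k * (2 * real k) ^ 1)\<bar>)"
      by (rule summable_odd_coeff) simp
    fix k r assume r: "r \<in> {0..1::real}"
    have "\<bar>r ^ k * cos (2 * real k * x - pi / 2)\<bar> \<le> 1 * 1"
      unfolding abs_mult using r by (intro mult_mono) (auto simp: power_le_one)
    hence "\<bar>- odd_coeff k / (real k * (2 * real k))\<bar> * \<bar>r ^ k * cos (2 * real k * x - pi / 2)\<bar>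
             \<le> \<bar>- odd_coeff k / (real k * (2 * real k))\<bar>"
      by (intro mult_left_le) auto
    thus "norm (- odd_coeff k / (real k * (2 * real k)) * r ^ k * cos (2 * real k * x - pi / 2))
             \<le> \<bar>- odd_coeff k / (real k * (2 * real k) ^ 1)\<bar>"
      by (simp add: abs_mult mult.assoc)
  qed
qed ((intro always_eventually allI continuous_on_sum continuous_on_mult continuous_on_const
           continuous_on_power continuous_on_id continuous_on_cos continuous_on_diff), simp)

text \<open>The imaginary parts are \<open>r * sin (2 * t)\<close> up to sign. They vanish only for
  \<open>r = 0\<close>, where both expressions equal 1.\<close>

lemma damped_log_tan_arg_nonzero:
  assumes "0 < t" "t < pi / 2"
  shows "1 - of_real r * cis (2 * t) \<noteq> 0" "1 + of_real r * cis (2 * t) \<noteq> 0"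
proof -
  have s: "sin (2 * t) > 0"
    using assms by (intro sin_gt_zero) auto
  show "1 - of_real r * cis (2 * t) \<noteq> 0"
  proof
    assume *: "1 - of_real r * cis (2 * t) = 0"
    hence "Im (1 - of_real r * cis (2 * t)) = 0" by simp
    with s have "r = 0" by simp
    with * show False by simp
  qed
  show "1 + of_real r * cis (2 * t) \<noteq> 0"
  proof
    assume *: "1 + of_real r * cis (2 * t) = 0"
    hence "Im (1 + of_real r * cis (2 * t)) = 0" by simp
    with s have "r = 0" by simp
    with * show False by simp
  qed
qed

text \<open>The half-angle formulas give moduli \<open>2 * sin t\<close> and
  \<open>2 * cos t\<close>.\<close>

lemma damped_log_tan_1:
  assumes "0 < t" "t < pi / 2"
  shows "damped_log_tan 1 t = ln (tan t)"
proof -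
  have s: "sin t > 0" and c: "cos t > 0"
    using assms by (auto intro: sin_gt_zero cos_gt_zero)
  have "1 - cis (2 * t) = - 2 * \<i> * of_real (sin t) * cis t"
    by (simp add: complex_eq_iff cos_double_sin sin_double power2_eq_square)
  hence n1: "norm (1 - cis (2 * t)) = 2 * sin t"
    using s by (simp add: norm_mult)
  have "1 + cis (2 * t) = 2 * of_real (cos t) * cis t"
    by (simp add: complex_eq_iff cos_double_cos sin_double power2_eq_square)
  hence n2: "norm (1 + cis (2 * t)) = 2 * cos t"
    using c by (simp add: norm_mult)
  show ?thesis
    using s c by (simp add: damped_log_tan_def n1 n2 tan_def ln_mult ln_div)
qed

text \<open>For \<open>r < 1\<close> the damped identity is the fundamental theorem of calculus.
  Both sides are continuous in \<open>r\<close> up to 1, so it survives the limit.\<close>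

lemma log_tan_prim_1_diff:
  assumes "0 < a" "a \<le> x" "x < pi / 2"
  shows "log_tan_prim (Suc 0) x - log_tan_prim (Suc 0) a = integral {a..x} (\<lambda>t. ln (tan t))"
proof -
  define D where
    "D = (\<lambda>r. damped_prim r x - damped_prim r a - integral {a..x} (damped_log_tan r))"
  \<comment> \<open>Staying strictly inside the interval from 0 to \<open>pi / 2\<close> keeps the
    logarithms away from their singularities, even at \<open>r = 1\<close>.\<close>
  have "continuous_on ({0..1} \<times> cbox a x) (\<lambda>(r, t). damped_log_tan r t)"
    unfolding damped_log_tan_def case_prod_unfold
    using damped_log_tan_arg_nonzero assms
    by (intro continuous_intros) auto
  hence "continuous_on {0..1} (\<lambda>r. integral (cbox a x) (damped_log_tan r))"
    by (rule integral_continuous_on_param)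
  hence "continuous_on (closure {0..<1}) D"
    unfolding D_def by (auto intro!: continuous_intros continuous_on_damped_prim)
  moreover have "D r = 0" if "r \<in> {0..<1}" for r
  proof -
    have "(damped_log_tan r has_integral damped_prim r x - damped_prim r a) {a..x}"
      using damped_prim_has_derivative[of r] that assms
      by (intro fundamental_theorem_of_calculus)
         (auto simp flip: has_real_derivative_iff_has_vector_derivative
               intro: has_field_derivative_at_within)
    thus ?thesis
      by (simp add: D_def integral_unique)
  qed
  ultimately have "D 1 = 0"
    by (rule continuous_constant_on_closure) auto
  moreover have "integral {a..x} (damped_log_tan 1) = integral {a..x} (\<lambda>t. ln (tan t))"
    using assms by (intro integral_cong damped_log_tan_1) auto
  ultimately show ?thesis
    by (simp add: D_def damped_prim_1)
qed

lemma log_tan_prim_1_has_derivative: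
  assumes "0 < x" "x < pi / 2"
  shows "(log_tan_prim (Suc 0) has_real_derivative ln (tan x)) (at x)"
proof -
  \<comment> \<open>Midpoints between \<open>x\<close> and the two singularities, so that
    \<open>x\<close> is interior to a compact interval on which \<open>ln (tan t)\<close> is
    continuous.\<close>
  define a b where "a = x / 2" and "b = (x + pi / 2) / 2"
  have ab: "0 < a" "a < x" "x < b" "b < pi / 2"
    using assms by (auto simp: a_def b_def)
  have "continuous_on {a..b} (\<lambda>t. ln (tan t))"
  proof (intro continuous_intros ballI)
    fix t assume "t \<in> {a..b}"
    hence t: "0 < t" "t < pi / 2" using ab by auto
    show "cos t \<noteq> 0" using cos_gt_zero[OF t] by simp
    show "tan t \<noteq> 0" using tan_gt_zero[OF t] by simp
  qed
  hence "((\<lambda>u. integral {a..u} (\<lambda>t. ln (tan t))) has_real_derivative ln (tan x))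
           (at x within {a..b})"
    using ab by (intro integral_has_real_derivative) auto
  hence "((\<lambda>u. log_tan_prim (Suc 0) a + integral {a..u} (\<lambda>t. ln (tan t))) has_real_derivative
           0 + ln (tan x)) (at x within {a..b})"
    by (intro DERIV_add DERIV_const)
  moreover have "log_tan_prim (Suc 0) a + integral {a..u} (\<lambda>t. ln (tan t)) = log_tan_prim (Suc 0) u"
    if "u \<in> {a..b}" for u
    using log_tan_prim_1_diff[of a u] that ab by simp
  ultimately have "(log_tan_prim (Suc 0) has_real_derivative ln (tan x)) (at x within {a..b})"
    using ab by (subst (asm) has_field_derivative_cong_eventually) (auto simp: eventually_at_filter)
  thus ?thesis
    using ab by (simp add: at_within_Icc_at)
qed

lemma log_tan_prim_has_derivative:
  assumes "0 < x" "x < pi / 2"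
  shows "(log_tan_prim (Suc j) has_real_derivative log_tan_prim j x) (at x)"
proof (cases j)
  case 0
  thus ?thesis
    using log_tan_prim_1_has_derivative[OF assms] by (simp add: log_tan_prim_def[of 0])
qed (use log_tan_prim_Suc_Suc_has_derivative in auto)

text \<open>Continuity is needed at 0 and \<open>pi / 2\<close> too, where
  \<open>log_tan_prim_1_has_derivative\<close> says nothing; for index 1 it comes from uniform
  convergence instead.\<close>

lemma continuous_on_log_tan_prim: "continuous_on A (log_tan_prim (Suc j))"
proof (cases j)
  case 0
  have "continuous_on UNIV (log_tan_prim (Suc 0))"
  proof (rule uniform_limit_theorem)
    let ?f = "\<lambda>k x. - odd_coeff k / (real k * (2 * real k) ^ Suc 0) *
                 cos (2 * real k * x - real (Suc 0) * (pi / 2))"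
    have eq: "log_tan_prim (Suc 0) = (\<lambda>x. \<Sum>k. ?f k x)"
      by (simp add: log_tan_prim_def fun_eq_iff)
    show "uniform_limit UNIV (\<lambda>n x. \<Sum>k<n. ?f k x) (log_tan_prim (Suc 0)) sequentially"
      unfolding eq
    proof (rule Weierstrass_m_test)
      fix k x
      show "norm (?f k x) \<le> \<bar>- odd_coeff k / (real k * (2 * real k) ^ Suc 0)\<bar>"
        unfolding real_norm_def abs_mult[of _ "cos _"] by (rule mult_left_le) auto
    qed (rule summable_odd_coeff, simp)
  qed ((intro always_eventually allI continuous_on_sum continuous_on_mult continuous_on_const
           continuous_on_power continuous_on_id continuous_on_cos continuous_on_diff), simp)
  thus ?thesis
    using 0 by (auto intro: continuous_on_subset)
next
  case (Suc i)
  thus ?thesis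
    using log_tan_prim_Suc_Suc_has_derivative
    by (intro continuous_at_imp_continuous_on ballI) (auto intro: DERIV_isCont)
qed

section \<open>The integral\<close>

text \<open>Integration by parts trades \<open>(Suc m, j)\<close> for \<open>(m, Suc j)\<close> at
  the cost of a factor \<open>- 2 / pi\<close>, so \<open>j\<close> has to vary in the induction.
  The fundamental theorem is used with derivatives in the interior only, which copes with the
  singular endpoints for \<open>j = 0\<close>.\<close>

lemma euler_appell_log_tan_prim_has_integral:
  "((\<lambda>x. euler_appell m (2 / pi * x) * log_tan_prim j x) has_integral
      (- 2 / pi) ^ m * (- 2 * log_tan_prim (Suc (m + j)) 0)) {0..pi / 2}"
proof (induction m arbitrary: j)
  case 0
  have "(log_tan_prim j has_integral (log_tan_prim (Suc j) (pi / 2) - log_tan_prim (Suc j) 0))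
          {0..pi / 2}"
    by (rule fundamental_theorem_of_calculus_interior)
       (auto intro: continuous_on_log_tan_prim log_tan_prim_has_derivative
             simp flip: has_real_derivative_iff_has_vector_derivative)
  thus ?case
    by (simp add: euler_appell_0 log_tan_prim_pi_half)
next
  case (Suc m)
  define F where "F = (\<lambda>x. euler_appell (Suc m) (2 / pi * x) * log_tan_prim (Suc j) x)"
  define f where "f = (\<lambda>x. euler_appell (Suc m) (2 / pi * x) * log_tan_prim j x)"
  define g where "g = (\<lambda>x. euler_appell m (2 / pi * x) * log_tan_prim (Suc j) x)"
  have E: "((\<lambda>x. euler_appell (Suc m) (2 / pi * x)) has_real_derivative
              2 / pi * euler_appell m (2 / pi * x)) (at x)" for x
  proof (rule DERIV_cong)
    show "((\<lambda>x. euler_appell (Suc m) (2 / pi * x)) has_real_derivative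
            euler_appell m (2 / pi * x) * (2 / pi * 1)) (at x)"
      by (rule DERIV_chain2[OF euler_appell_has_derivative DERIV_cmult[OF DERIV_ident]])
  qed simp
  have "((\<lambda>x. f x + 2 / pi * g x) has_integral F (pi / 2) - F 0) {0..pi / 2}"
  proof (rule fundamental_theorem_of_calculus_interior)
    have "continuous_on {0..pi / 2} (\<lambda>x. euler_appell (Suc m) (2 / pi * x))"
      using E by (intro continuous_at_imp_continuous_on ballI) (rule DERIV_isCont)
    thus "continuous_on {0..pi / 2} F"
      unfolding F_def by (intro continuous_on_mult continuous_on_log_tan_prim)
  next
    fix x assume "x \<in> {0<..<pi / 2}"
    hence "(log_tan_prim (Suc j) has_real_derivative log_tan_prim j x) (at x)"
      by (intro log_tan_prim_has_derivative) auto
    from DERIV_mult[OF E this]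
    show "(F has_vector_derivative f x + 2 / pi * g x) (at x)"
      unfolding has_real_derivative_iff_has_vector_derivative[symmetric]
      by (simp add: F_def f_def g_def mult_ac add_ac)
  qed simp
  \<comment> \<open>Both factors are tied across the interval: the antiderivative changes sign, and
    the polynomial values at 0 and 1 are opposite.\<close>
  moreover have "F (pi / 2) - F 0 = 0"
  proof -
    have "F (pi / 2) - F 0 =
            - (euler_appell (Suc m) 0 + euler_appell (Suc m) 1) * log_tan_prim (Suc j) 0"
      by (simp add: F_def log_tan_prim_pi_half algebra_simps)
    thus ?thesis
      by (simp add: euler_appell_0_plus_1)
  qed
  ultimately have "((\<lambda>x. f x + 2 / pi * g x) has_integral 0) {0..pi / 2}"
    by simp
  moreover have "((\<lambda>x. 2 / pi * g x) has_integral
      2 / pi * ((- 2 / pi) ^ m * (- 2 * log_tan_prim (Suc (m + Suc j)) 0))) {0..pi / 2}"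
    unfolding g_def by (rule has_integral_mult_right) (rule Suc.IH)
  ultimately have "((\<lambda>x. f x + 2 / pi * g x - 2 / pi * g x) has_integral
      0 - 2 / pi * ((- 2 / pi) ^ m * (- 2 * log_tan_prim (Suc (m + Suc j)) 0))) {0..pi / 2}"
    by (rule has_integral_diff)
  thus ?case
    by (simp add: f_def)
qed

section \<open>Values at 0 in terms of zeta\<close>

lemma zeta_sums:
  assumes "s \<ge> 2"
  shows "(\<lambda>k. inverse (real k ^ s)) sums zeta (real s)"
proof -
  have sm: "summable (\<lambda>k. inverse (real k ^ s))"
    by (rule inverse_power_summable) (rule assms)
  have "zeta (real s) = (\<Sum>k. inverse (real (Suc k) ^ s))"
    by (simp add: zeta_def powr_minus powr_realpow del: of_nat_Suc)
  also have "\<dots> = (\<Sum>k. inverse (real k ^ s))"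
    using suminf_split_head[OF sm] assms by simp
  finally show ?thesis
    using sm by (simp add: sums_iff)
qed

text \<open>\<open>odd_coeff k\<close> is 2 minus \<open>1 + (- 1) ^ k\<close>. The latter lives on
  even \<open>k\<close>, and reindexing by \<open>2 * k\<close> pulls out the factor
  \<open>2 / 2 ^ s\<close>.\<close>

lemma odd_coeff_sums:
  assumes "s \<ge> 2"
  shows "(\<lambda>k. odd_coeff k / real k ^ s) sums ((2 - 2 / 2 ^ s) * zeta (real s))"
proof -
  let ?h = "\<lambda>k. (1 + (- 1) ^ k) / real k ^ s"
  have "(\<lambda>k. 2 / 2 ^ s * inverse (real k ^ s)) sums (2 / 2 ^ s * zeta (real s))"
    by (intro sums_mult zeta_sums assms)
  also have "(\<lambda>k. 2 / 2 ^ s * inverse (real k ^ s)) = (\<lambda>k. ?h (2 * k))"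
    by (simp add: fun_eq_iff power_mult_distrib field_simps)
  also have "\<dots> sums (2 / 2 ^ s * zeta (real s)) \<longleftrightarrow> ?h sums (2 / 2 ^ s * zeta (real s))"
  proof (rule sums_mono_reindex)
    fix k :: nat assume "k \<notin> range (\<lambda>k. 2 * k)"
    hence "odd k" by auto
    thus "?h k = 0" by simp
  qed (auto simp: strict_mono_def)
  finally have "?h sums (2 / 2 ^ s * zeta (real s))" .
  hence "(\<lambda>k. 2 * inverse (real k ^ s) - ?h k) sums (2 * zeta (real s) - 2 / 2 ^ s * zeta (real s))"
    by (intro sums_diff sums_mult zeta_sums assms)
  also have "(\<lambda>k. 2 * inverse (real k ^ s) - ?h k) = (\<lambda>k. odd_coeff k / real k ^ s)"
    by (simp add: fun_eq_iff odd_coeff_def divide_inverse algebra_simps)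
  also have "2 * zeta (real s) - 2 / 2 ^ s * zeta (real s) = (2 - 2 / 2 ^ s) * zeta (real s)"
    by (simp add: algebra_simps)
  finally show ?thesis .
qed

text \<open>At \<open>x = 0\<close> only the phase remains in the cosine, so it is the same for all
  \<open>k\<close> and leaves the sum.\<close>

lemma log_tan_prim_at_0:
  assumes "j > 0"
  shows "log_tan_prim j 0 =
           - cos (real j * (pi / 2)) / 2 ^ j * ((2 - 2 / 2 ^ Suc j) * zeta (real (Suc j)))"
proof -
  have "(\<lambda>k. - cos (real j * (pi / 2)) / 2 ^ j * (odd_coeff k / real k ^ Suc j)) sums
          (- cos (real j * (pi / 2)) / 2 ^ j * ((2 - 2 / 2 ^ Suc j) * zeta (real (Suc j))))"
    by (intro sums_mult odd_coeff_sums) (use assms in simp)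
  moreover have "(\<lambda>k. - cos (real j * (pi / 2)) / 2 ^ j * (odd_coeff k / real k ^ Suc j)) =
      (\<lambda>k. - odd_coeff k / (real k * (2 * real k) ^ j) * cos (2 * real k * 0 - real j * (pi / 2)))"
    by (simp add: fun_eq_iff power_mult_distrib field_simps)
  ultimately show ?thesis
    using assms unfolding log_tan_prim_def by (simp add: sums_iff)
qed

text \<open>Treats both parities of \<open>m\<close> together: the cosine is 0 for even
  \<open>m\<close> and a sign for odd \<open>m\<close>.\<close>

lemma euler_poly_log_tan_has_integral:
  "((\<lambda>x. euler_poly m (2 / pi * x) * ln (tan x)) has_integral
      (- 1) ^ m * fact m / pi ^ m * cos (real (Suc m) * (pi / 2)) *
        (2 - 2 / 2 ^ (m + 2)) * zeta (real (m + 2))) {0..pi / 2}"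
proof -
  have "((\<lambda>x. fact m * (euler_appell m (2 / pi * x) * log_tan_prim 0 x)) has_integral
          fact m * ((- 2 / pi) ^ m * (- 2 * log_tan_prim (Suc (m + 0)) 0))) {0..pi / 2}"
    by (intro has_integral_mult_right euler_appell_log_tan_prim_has_integral)
  moreover have "fact m * ((- 2 / pi) ^ m * (- 2 * log_tan_prim (Suc (m + 0)) 0)) =
      (- 1) ^ m * fact m / pi ^ m * cos (real (Suc m) * (pi / 2)) *
        (2 - 2 / 2 ^ (m + 2)) * zeta (real (m + 2))"
  proof -
    \<comment> \<open>The powers of 2 cancel, \<open>2 ^ m * 2\<close> against
      \<open>2 ^ Suc m\<close>.\<close>
    have "fact m * ((- 2 / pi) ^ m * (- 2 * (- C / 2 ^ Suc m * Z))) =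
            (- 1) ^ m * fact m / pi ^ m * C * Z" for C Z :: real
      using power_minus[of "2 / pi" m] by (simp add: power_divide)
    thus ?thesis
      unfolding add_0_right log_tan_prim_at_0[OF zero_less_Suc]
      by (simp only: mult.assoc add_2_eq_Suc')
  qed
  ultimately show ?thesis
    by (simp add: euler_poly_conv_appell log_tan_prim_def[of 0] mult.assoc)
qed

theorem theorem1:
  fixes n :: nat
  assumes "n > 0"
  shows "((\<lambda>x::real. euler_poly (2 * n) (2 / pi * x) * ln (tan x)) has_integral 0) {0..pi / 2} \<and>
         ((\<lambda>x::real. euler_poly (2 * n - 1) (2 / pi * x) * ln (tan x)) has_integral
            ((- 1) ^ (n - 1) * fact (2 * n - 1) / pi ^ (2 * n - 1) *
              (2 - 2 powi (- int (2 * n))) * zeta (2 * real n + 1))) {0..pi / 2}"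
proof
  have "cos (real (Suc (2 * n)) * (pi / 2)) = cos (real n * pi + pi / 2)"
    by (simp add: algebra_simps)
  also have "\<dots> = 0"
    by (simp add: cos_add)
  finally show "((\<lambda>x::real. euler_poly (2 * n) (2 / pi * x) * ln (tan x)) has_integral 0) {0..pi / 2}"
    using euler_poly_log_tan_has_integral[of "2 * n"] by simp
next
  obtain k where k: "n = Suc k"
    using assms by (cases n) auto
  have "cos (real (Suc (2 * n - 1)) * (pi / 2)) = cos (real n * pi)"
    using assms by (simp add: algebra_simps)
  \<comment> \<open>This minus sign later cancels against
    \<open>(- 1) ^ (2 * n - 1) = - 1\<close>.\<close>
  also have "\<dots> = - ((- 1) ^ (n - 1))"
    by (simp only: k cos_npi) simp
  finally have c: "cos (real (Suc (2 * n - 1)) * (pi / 2)) = - ((- 1) ^ (n - 1))" .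
  have p: "2 / 2 ^ (2 * n - 1 + 2) = (2 :: real) powi (- int (2 * n))"
    using assms unfolding power_int_minus power_int_of_nat
    by (simp add: k field_simps)
  have z: "real (2 * n - 1 + 2) = 2 * real n + 1" and m: "odd (2 * n - 1)"
    using assms by auto
  show "((\<lambda>x::real. euler_poly (2 * n - 1) (2 / pi * x) * ln (tan x)) has_integral
          ((- 1) ^ (n - 1) * fact (2 * n - 1) / pi ^ (2 * n - 1) *
            (2 - 2 powi (- int (2 * n))) * zeta (2 * real n + 1))) {0..pi / 2}"
    by (rule has_integral_eq_rhs[OF euler_poly_log_tan_has_integral])
       (unfold c p z, use m in simp)
qed

end
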